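(* Let $\mathcal T$ be the vector space spanned by rooted trees and let $V$ be the vector space spanned by the couples $(t,s)$ where $t$ is a rooted tree and $s=P^{c_0}(t)$ is the pruning of $t$ by an admissible cut $c_0$ of $t$. Define bilinearly, for $t_1\in\mathcal T$ and couples $(t_2,s_2),(t_3,s_3)\in V$, $$(t_2,s_2)\leadsto(t_3,s_3):=\sum_{v\in\mathcal V(t_3-s_3)}(t_2\rightarrow_v t_3,\,s_2s_3),\qquad t_1\Diamond(t_2,s_2):=\sum_{v\in\mathcal V(s_2)}(t_1\rightarrow_v t_2,\,t_1\rightarrow_v s_2).$$ Then $\Diamond$ is a derivation of the algebra $(V,\leadsto)$. In other words, for any $t_1\in\mathcal T$ and $(t_2,s_2),(t_3,s_3)\in V$, $$t_1\Diamond\big((t_2,s_2)\leadsto(t_3,s_3)\big)=\big(t_1\Diamond(t_2,s_2)\big)\leadsto(t_3,s_3)+(t_2,s_2)\leadsto\big(t_1\Diamond(t_3,s_3)\big).$$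
   Context: Rooted trees are finite, non-planar, non-empty. A forest is a finite (possibly empty) disjoint union of rooted trees. For a tree $t$, a tree or forest $s$, and a vertex $v$ of $s$, $t\rightarrow_v s$ is obtained by grafting the root of $t$ on the vertex $v$ of $s$ (adding an edge from $v$ to the root of $t$). An admissible cut $c$ of a tree $t$ is a collection of edges such that any path from the root to a leaf contains at most one edge of the collection. The pruning $P^c(t)$ is the subforest above the cut. The empty cut (pruning empty) and the total cut (pruning $t$) are both counted as admissible. In a couple $(t,s)\in V$, $s$ is regarded as a subforest of $t$. $\mathcal V(s)$ is the set of vertices of $s$, and $\mathcal V(t-s)$ is the set of vertices of $t$ that are not vertices of $s$. $s_2s_3$ is the disjoint union, viewed as a subforest of $t_2\rightarrow_v t_3$. *)

theory Defs
  imports Complex_Main "HOL-Library.Poly_Mapping" "HOL-Library.Nat_Bijection"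
begin

section \<open>Rooted forests and rooted trees\<close>

text \<open>An edge \<open>(u, v)\<close> goes from the parent \<open>u\<close> to its child \<open>v\<close>.\<close>

datatype 'a rgraph = RGraph (verts: "'a set") (edges: "('a \<times> 'a) set")

definition roots :: "'a rgraph \<Rightarrow> 'a set" where
  "roots F = {v \<in> verts F. \<forall>u. (u, v) \<notin> edges F}"

definition leaves :: "'a rgraph \<Rightarrow> 'a set" where
  "leaves F = {v \<in> verts F. \<forall>w. (v, w) \<notin> edges F}"

definition rooted_forest :: "'a rgraph \<Rightarrow> bool" where
  "rooted_forest F \<longleftrightarrow>
     finite (verts F) \<and> edges F \<subseteq> verts F \<times> verts F \<and> acyclic (edges F) \<and>
     (\<forall>u u' v. (u, v) \<in> edges F \<longrightarrow> (u', v) \<in> edges F \<longrightarrow> u = u')"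

definition rooted_tree :: "'a rgraph \<Rightarrow> bool" where
  "rooted_tree t \<longleftrightarrow> rooted_forest t \<and> (\<exists>!r. r \<in> roots t)"

definition root_of :: "'a rgraph \<Rightarrow> 'a" where
  "root_of t = (THE r. r \<in> roots t)"

definition induced :: "'a rgraph \<Rightarrow> 'a set \<Rightarrow> 'a rgraph" where
  "induced F W = RGraph (verts F \<inter> W) (edges F \<inter> W \<times> W)"

definition relabel :: "('a \<Rightarrow> 'b) \<Rightarrow> 'a rgraph \<Rightarrow> 'b rgraph" where
  "relabel f F = RGraph (f ` verts F) (map_prod f f ` edges F)"

definition disj_union :: "'a rgraph \<Rightarrow> 'b rgraph \<Rightarrow> ('a + 'b) rgraph" where
  "disj_union F G =
     RGraph (verts F <+> verts G) (map_prod Inl Inl ` edges F \<union> map_prod Inr Inr ` edges G)"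

text \<open>\<open>graft t v s\<close> is \<open>t \<rightarrow>\<^sub>v s\<close>, for a tree \<open>t\<close> and a vertex \<open>v\<close> of a tree or forest \<open>s\<close>.\<close>

definition graft :: "'a rgraph \<Rightarrow> 'b \<Rightarrow> 'b rgraph \<Rightarrow> ('a + 'b) rgraph" where
  "graft t v s =
     RGraph (verts (disj_union t s)) (insert (Inr v, Inl (root_of t)) (edges (disj_union t s)))"


section \<open>Admissible cuts\<close>

definition root_leaf_path :: "'a rgraph \<Rightarrow> 'a list \<Rightarrow> bool" where
  "root_leaf_path t xs \<longleftrightarrow>
     xs \<noteq> [] \<and> hd xs = root_of t \<and> last xs \<in> leaves t \<and> successively (\<lambda>u v. (u, v) \<in> edges t) xs"

definition path_edges :: "'a list \<Rightarrow> ('a \<times> 'a) set" where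
  "path_edges xs = set (zip xs (tl xs))"

text \<open>The total cut, whose pruning is the whole tree, is not given by a set of edges. The empty cut
  is \<open>Edge_Cut {}\<close>.\<close>

datatype 'a cut = Total_Cut | Edge_Cut "('a \<times> 'a) set"

fun admissible_cut :: "'a rgraph \<Rightarrow> 'a cut \<Rightarrow> bool" where
  "admissible_cut t Total_Cut \<longleftrightarrow> True"
| "admissible_cut t (Edge_Cut c) \<longleftrightarrow>
     c \<subseteq> edges t \<and> (\<forall>xs. root_leaf_path t xs \<longrightarrow> card (c \<inter> path_edges xs) \<le> 1)"

fun pruning :: "'a rgraph \<Rightarrow> 'a cut \<Rightarrow> 'a rgraph" where
  "pruning t Total_Cut = t"
| "pruning t (Edge_Cut c) = induced t {w. \<exists>(p, x) \<in> c. (x, w) \<in> (edges t)\<^sup>*}"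

definition is_couple :: "'a rgraph \<times> 'a rgraph \<Rightarrow> bool" where
  "is_couple = (\<lambda>(t, s). rooted_tree t \<and> (\<exists>c. admissible_cut t c \<and> s = pruning t c))"


section \<open>Isomorphism classes\<close>

text \<open>Non-planar trees are isomorphism classes. A couple \<open>(t, s)\<close> is taken up to isomorphisms of
  \<open>t\<close> that carry the subforest \<open>s\<close> along: the position of \<open>s\<close> in \<open>t\<close> is part of the datum. Natural
  numbers suffice as vertices, since all the trees are finite.\<close>

definition tree_iso :: "'a rgraph \<Rightarrow> 'a rgraph \<Rightarrow> bool" where
  "tree_iso t t' \<longleftrightarrow> rooted_tree t \<and> rooted_tree t' \<and> (\<exists>f. inj_on f (verts t) \<and> t' = relabel f t)"

definition couple_iso :: "'a rgraph \<times> 'a rgraph \<Rightarrow> 'a rgraph \<times> 'a rgraph \<Rightarrow> bool" where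
  "couple_iso = (\<lambda>(t, s) (t', s'). is_couple (t, s) \<and> is_couple (t', s') \<and>
     (\<exists>f. inj_on f (verts t) \<and> t' = relabel f t \<and> s' = relabel f s))"

lemma verts_relabel [simp]: "verts (relabel f F) = f ` verts F"
  and edges_relabel [simp]: "edges (relabel f F) = map_prod f f ` edges F"
  by (simp_all add: relabel_def)

lemma relabel_relabel: "relabel g (relabel f F) = relabel (g \<circ> f) F"
  by (simp add: relabel_def image_image map_prod_def case_prod_beta)

lemma rooted_forest_sub: "rooted_forest F \<Longrightarrow> (u, v) \<in> edges F \<Longrightarrow> u \<in> verts F \<and> v \<in> verts F"
  by (auto simp: rooted_forest_def)

lemma rooted_tree_forest: "rooted_tree t \<Longrightarrow> rooted_forest t"
  by (simp add: rooted_tree_def)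

lemma relabel_cong:
  assumes "edges F \<subseteq> verts F \<times> verts F" "\<And>x. x \<in> verts F \<Longrightarrow> f x = g x"
  shows "relabel f F = relabel g F"
proof -
  have "map_prod f f ` edges F = map_prod g g ` edges F"
    using assms by (intro image_cong) auto
  moreover have "f ` verts F = g ` verts F" using assms by (intro image_cong) auto
  ultimately show ?thesis by (simp add: relabel_def)
qed

lemma relabel_ident:
  assumes "edges F \<subseteq> verts F \<times> verts F" "\<And>x. x \<in> verts F \<Longrightarrow> f x = x"
  shows "relabel f F = F"
proof -
  have "relabel f F = relabel id F" using assms by (intro relabel_cong) auto
  then show ?thesis by (simp add: relabel_def map_prod.id)
qed

lemma acyclic_height:
  assumes "finite E"
  shows "acyclic E \<longleftrightarrow> (\<exists>h :: 'a \<Rightarrow> nat. \<forall>u v. (u, v) \<in> E \<longrightarrow> h u < h v)"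
proof
  assume ac: "acyclic E"
  define h where "h v = card {u. (u, v) \<in> E\<^sup>+}" for v
  have "h u < h v" if uv: "(u, v) \<in> E" for u v
  proof -
    have "finite {u. (u, v) \<in> E\<^sup>+}"
    proof (rule finite_subset)
      show "{u. (u, v) \<in> E\<^sup>+} \<subseteq> Domain E"
        using trancl_domain[of E] by blast
      show "finite (Domain E)" using assms by (simp add: finite_Domain)
    qed
    moreover have "{w. (w, u) \<in> E\<^sup>+} \<subset> {w. (w, v) \<in> E\<^sup>+}"
    proof
      show "{w. (w, u) \<in> E\<^sup>+} \<subseteq> {w. (w, v) \<in> E\<^sup>+}"
        using uv by (auto intro: trancl_into_trancl)
      have "u \<in> {w. (w, v) \<in> E\<^sup>+}" "u \<notin> {w. (w, u) \<in> E\<^sup>+}"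
        using uv ac by (auto simp: acyclic_def)
      then show "{w. (w, u) \<in> E\<^sup>+} \<noteq> {w. (w, v) \<in> E\<^sup>+}" by blast
    qed
    ultimately show ?thesis unfolding h_def by (rule psubset_card_mono)
  qed
  then show "\<exists>h :: 'a \<Rightarrow> nat. \<forall>u v. (u, v) \<in> E \<longrightarrow> h u < h v" by blast
next
  assume "\<exists>h :: 'a \<Rightarrow> nat. \<forall>u v. (u, v) \<in> E \<longrightarrow> h u < h v"
  then obtain h :: "'a \<Rightarrow> nat" where h: "\<And>u v. (u, v) \<in> E \<Longrightarrow> h u < h v" by blast
  have "h u < h v" if "(u, v) \<in> E\<^sup>+" for u v
    using that by (induction rule: trancl_induct) (auto dest: h)
  then show "acyclic E" unfolding acyclic_def by blast
qed

lemma rooted_forest_height: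
  "rooted_forest F \<longleftrightarrow>
     finite (verts F) \<and> edges F \<subseteq> verts F \<times> verts F \<and>
     (\<exists>h :: 'a \<Rightarrow> nat. \<forall>u v. (u, v) \<in> edges F \<longrightarrow> h u < h v) \<and>
     (\<forall>u u' v. (u, v) \<in> edges F \<longrightarrow> (u', v) \<in> edges F \<longrightarrow> u = u')"
proof -
  have "acyclic (edges F) \<longleftrightarrow> (\<exists>h :: 'a \<Rightarrow> nat. \<forall>u v. (u, v) \<in> edges F \<longrightarrow> h u < h v)"
    if "finite (verts F)" "edges F \<subseteq> verts F \<times> verts F"
    by (rule acyclic_height, rule finite_subset[OF that(2)]) (use that(1) in simp)
  then show ?thesis unfolding rooted_forest_def by (intro iffI conjI; elim conjE) simp_all
qed

lemma rooted_forest_ex_height: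
  "rooted_forest F \<Longrightarrow> \<exists>h :: 'a \<Rightarrow> nat. \<forall>u v. (u, v) \<in> edges F \<longrightarrow> h u < h v"
  unfolding rooted_forest_height by (elim conjE)

lemma rooted_forest_finite: "rooted_forest F \<Longrightarrow> finite (verts F)"
  and rooted_forest_parent:
    "rooted_forest F \<Longrightarrow> (u, v) \<in> edges F \<Longrightarrow> (u', v) \<in> edges F \<Longrightarrow> u = u'"
  by (simp add: rooted_forest_def) (auto simp: rooted_forest_def)

lemma roots_tree:
  assumes "rooted_tree t"
  shows "roots t = {root_of t}"
proof -
  obtain r where "roots t = {r}" using assms by (auto simp: rooted_tree_def)
  then show ?thesis by (simp add: root_of_def)
qed

lemma rooted_treeI: "rooted_forest t \<Longrightarrow> roots t = {r} \<Longrightarrow> rooted_tree t"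
  by (auto simp: rooted_tree_def)

lemma root_eqI: "roots t = {r} \<Longrightarrow> root_of t = r"
  by (simp add: root_of_def)

lemma root_in_verts: "rooted_tree t \<Longrightarrow> root_of t \<in> verts t"
  using roots_tree[of t] by (auto simp: roots_def)

lemma rooted_tree_reachable:
  assumes "rooted_tree t" "v \<in> verts t"
  shows "(root_of t, v) \<in> (edges t)\<^sup>*"
proof -
  have "\<exists>h :: 'a \<Rightarrow> nat. \<forall>u v. (u, v) \<in> edges t \<longrightarrow> h u < h v"
    by (rule rooted_forest_ex_height[OF rooted_tree_forest[OF assms(1)]])
  then obtain h :: "'a \<Rightarrow> nat" where "\<forall>u v. (u, v) \<in> edges t \<longrightarrow> h u < h v" by (rule exE)
  then have h: "(u, v) \<in> edges t \<Longrightarrow> h u < h v" for u v by simp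
  show ?thesis using assms(2)
  proof (induction "h v" arbitrary: v rule: less_induct)
    case less
    show ?case
    proof (cases "v \<in> roots t")
      case True
      then show ?thesis using roots_tree[OF assms(1)] by auto
    next
      case False
      then obtain u where u: "(u, v) \<in> edges t" using less.prems by (auto simp: roots_def)
      then have "(root_of t, u) \<in> (edges t)\<^sup>*"
        using less.hyps[of u] h rooted_forest_sub[OF rooted_tree_forest[OF assms(1)]] by blast
      then show ?thesis using u by (rule rtrancl_into_rtrancl)
    qed
  qed
qed

lemma relabel_tree:
  assumes t: "rooted_tree t" and f: "inj_on f (verts t)"
  shows "rooted_tree (relabel f t)" and "root_of (relabel f t) = f (root_of t)"
proof -
  note sub = rooted_forest_sub[OF rooted_tree_forest[OF t]]
  have "\<exists>h :: 'a \<Rightarrow> nat. \<forall>u v. (u, v) \<in> edges t \<longrightarrow> h u < h v"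
    by (rule rooted_forest_ex_height[OF rooted_tree_forest[OF t]])
  then obtain h :: "'a \<Rightarrow> nat" where "\<forall>u v. (u, v) \<in> edges t \<longrightarrow> h u < h v" by (rule exE)
  then have h: "(u, v) \<in> edges t \<Longrightarrow> h u < h v" for u v by simp
  have fin: "finite (verts t)" and uniq: "\<And>u u' v. (u, v) \<in> edges t \<Longrightarrow> (u', v) \<in> edges t \<Longrightarrow> u = u'"
    using rooted_forest_finite rooted_forest_parent rooted_tree_forest[OF t] by auto
  have "h (the_inv_into (verts t) f u) < h (the_inv_into (verts t) f v)"
    if "(u, v) \<in> edges (relabel f t)" for u v
    using that h sub f by (auto simp: the_inv_into_f_f)
  then have height: "\<exists>h :: 'b \<Rightarrow> nat. \<forall>u v. (u, v) \<in> edges (relabel f t) \<longrightarrow> h u < h v"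
    by (intro exI[of _ "\<lambda>x. h (the_inv_into (verts t) f x)"]) blast
  have "rooted_forest (relabel f t)"
    unfolding rooted_forest_height
  proof (intro conjI height allI impI)
    show "finite (verts (relabel f t))" using fin by simp
    show "edges (relabel f t) \<subseteq> verts (relabel f t) \<times> verts (relabel f t)" using sub by auto
    fix x x' y
    assume "(x, y) \<in> edges (relabel f t)" "(x', y) \<in> edges (relabel f t)"
    then obtain a b a' b' where ab: "(a, b) \<in> edges t" "x = f a" "y = f b"
      and ab': "(a', b') \<in> edges t" "x' = f a'" "y = f b'" by auto
    have "b = b'" using inj_onD[OF f, of b b'] ab ab' sub by auto
    then show "x = x'" using uniq ab ab' by auto
  qed
  moreover have "roots (relabel f t) = f ` roots t"
  proof (intro set_eqI iffI)
    fix y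
    assume "y \<in> roots (relabel f t)"
    then obtain v where v: "v \<in> verts t" "y = f v" "\<And>x. (x, f v) \<notin> edges (relabel f t)"
      by (auto simp: roots_def)
    have "(u, v) \<notin> edges t" for u using v(3)[of "f u"] by force
    then show "y \<in> f ` roots t" using v by (auto simp: roots_def)
  next
    fix y
    assume "y \<in> f ` roots t"
    then obtain v where v: "v \<in> verts t" "y = f v" "\<And>u. (u, v) \<notin> edges t"
      by (auto simp: roots_def)
    have "(x, f v) \<notin> edges (relabel f t)" for x
      using v sub inj_onD[OF f, of _ v] by fastforce
    then show "y \<in> roots (relabel f t)" using v by (auto simp: roots_def)
  qed
  then have "roots (relabel f t) = {f (root_of t)}" using roots_tree[OF t] by simp
  ultimately show "rooted_tree (relabel f t)" "root_of (relabel f t) = f (root_of t)"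
    by (auto intro: rooted_treeI root_eqI)
qed

lemma verts_graft [simp]: "verts (graft t v s) = verts t <+> verts s"
  by (simp add: graft_def disj_union_def)

lemma edges_graft [simp]: "edges (graft t v s) =
    insert (Inr v, Inl (root_of t)) (map_prod Inl Inl ` edges t \<union> map_prod Inr Inr ` edges s)"
  by (simp add: graft_def disj_union_def)

lemma verts_disj_union [simp]: "verts (disj_union t s) = verts t <+> verts s"
  and edges_disj_union [simp]:
    "edges (disj_union t s) = map_prod Inl Inl ` edges t \<union> map_prod Inr Inr ` edges s"
  by (simp_all add: disj_union_def)

lemma graft_tree:
  assumes t: "rooted_tree t" and s: "rooted_tree s" and v: "v \<in> verts s"
  shows "rooted_tree (graft t v s)" and "root_of (graft t v s) = Inr (root_of s)"
proof -
  note subt = rooted_forest_sub[OF rooted_tree_forest[OF t]]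
  note subs = rooted_forest_sub[OF rooted_tree_forest[OF s]]
  have "\<exists>h :: 'a \<Rightarrow> nat. \<forall>u v. (u, v) \<in> edges t \<longrightarrow> h u < h v"
    by (rule rooted_forest_ex_height[OF rooted_tree_forest[OF t]])
  then obtain h :: "'a \<Rightarrow> nat" where "\<forall>u v. (u, v) \<in> edges t \<longrightarrow> h u < h v" by (rule exE)
  then have h: "(u, v) \<in> edges t \<Longrightarrow> h u < h v" for u v by simp
  have "\<exists>k :: 'b \<Rightarrow> nat. \<forall>u v. (u, v) \<in> edges s \<longrightarrow> k u < k v"
    by (rule rooted_forest_ex_height[OF rooted_tree_forest[OF s]])
  then obtain k :: "'b \<Rightarrow> nat" where "\<forall>u v. (u, v) \<in> edges s \<longrightarrow> k u < k v" by (rule exE)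
  then have k: "(u, v) \<in> edges s \<Longrightarrow> k u < k v" for u v by simp
  have fint: "finite (verts t)" and uniqt: "\<And>u u' v. (u, v) \<in> edges t \<Longrightarrow> (u', v) \<in> edges t \<Longrightarrow> u = u'"
    using rooted_forest_finite rooted_forest_parent rooted_tree_forest[OF t] by auto
  have fins: "finite (verts s)" and uniqs: "\<And>u u' v. (u, v) \<in> edges s \<Longrightarrow> (u', v) \<in> edges s \<Longrightarrow> u = u'"
    using rooted_forest_finite rooted_forest_parent rooted_tree_forest[OF s] by auto
  have rt: "root_of t \<in> verts t" "\<And>u. (u, root_of t) \<notin> edges t"
    using roots_tree[OF t] by (auto simp: roots_def)
  have hh: "case_sum (\<lambda>a. h a + k v + 1) k x < case_sum (\<lambda>a. h a + k v + 1) k y"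
    if "(x, y) \<in> edges (graft t v s)" for x y
    using that h k by auto
  have "rooted_forest (graft t v s)"
    unfolding rooted_forest_height
  proof (intro conjI)
    show "finite (verts (graft t v s))" using fint fins by simp
    show "edges (graft t v s) \<subseteq> verts (graft t v s) \<times> verts (graft t v s)"
      using subt subs v rt by auto
    show "\<exists>h :: 'a + 'b \<Rightarrow> nat. \<forall>x y. (x, y) \<in> edges (graft t v s) \<longrightarrow> h x < h y"
      by (intro exI[of _ "case_sum (\<lambda>a. h a + k v + 1) k"] allI impI hh)
    show "\<forall>x x' y. (x, y) \<in> edges (graft t v s) \<longrightarrow> (x', y) \<in> edges (graft t v s) \<longrightarrow> x = x'"
      using rt uniqt uniqs by auto
  qed
  moreover have "roots (graft t v s) = {Inr (root_of s)}"
  proof -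
    have "Inl a \<notin> roots (graft t v s)" for a
    proof
      assume a: "Inl a \<in> roots (graft t v s)"
      then have n: "(x, Inl a) \<notin> edges (graft t v s)" for x by (simp add: roots_def)
      have "(u, a) \<notin> edges t" for u
        using n[of "Inl u"] by force
      then have "a \<in> roots t" using a by (auto simp: roots_def)
      then have "a = root_of t" using roots_tree[OF t] by simp
      then show False using n[of "Inr v"] by simp
    qed
    moreover have "Inr b \<in> roots (graft t v s) \<longleftrightarrow> b \<in> roots s" for b
      by (auto simp: roots_def)
    ultimately have "x \<in> roots (graft t v s) \<longleftrightarrow> x \<in> Inr ` roots s" for x
      by (cases x) auto
    then show ?thesis using roots_tree[OF s] by auto
  qed
  ultimately show "rooted_tree (graft t v s)" "root_of (graft t v s) = Inr (root_of s)"
    by (auto intro: rooted_treeI root_eqI)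
qed

lemma is_couple_iff:
  "is_couple (t, s) \<longleftrightarrow> rooted_tree t \<and> verts s \<subseteq> verts t \<and>
     edges s = {(u, v) \<in> edges t. u \<in> verts s} \<and> (\<forall>(u, v) \<in> edges t. u \<in> verts s \<longrightarrow> v \<in> verts s)"
  (is "?L \<longleftrightarrow> ?R")
proof
  assume ?L
  then obtain c where t: "rooted_tree t" and c: "admissible_cut t c" and s: "s = pruning t c"
    by (auto simp: is_couple_def)
  note sub = rooted_forest_sub[OF rooted_tree_forest[OF t]]
  show ?R
  proof (cases c)
    case Total_Cut
    then show ?thesis using t s sub by auto
  next
    case (Edge_Cut C)
    define W where "W = {w. \<exists>(p, x) \<in> C. (x, w) \<in> (edges t)\<^sup>*}"
    have W: "v \<in> W" if "u \<in> W" "(u, v) \<in> edges t" for u v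
      using that unfolding W_def by (simp add: case_prod_beta) (meson rtrancl_into_rtrancl)
    show ?thesis using t s sub W unfolding Edge_Cut by (auto simp: induced_def W_def[symmetric])
  qed
next
  assume R: ?R
  then have t: "rooted_tree t" by blast
  note sub = rooted_forest_sub[OF rooted_tree_forest[OF t]]
  define W where "W = verts s"
  have Wt: "W \<subseteq> verts t" using R by (simp add: W_def)
  have W: "v \<in> W" if "(u, v) \<in> edges t" "u \<in> W" for u v
    using R that unfolding W_def by auto
  have "edges s = {(u, v) \<in> edges t. u \<in> W}" using R by (simp add: W_def)
  then have es: "edges s = edges t \<inter> W \<times> W" using W by auto
  have Ws: "v \<in> W" if "(u, v) \<in> (edges t)\<^sup>*" "u \<in> W" for u v
    using that by (induction rule: rtrancl_induct) (auto dest: W)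
  have s: "s = induced t W"
    using es Wt unfolding induced_def W_def by (intro rgraph.expand) auto
  show ?L
  proof (cases "root_of t \<in> W")
    case True
    then have "verts t \<subseteq> W" using rooted_tree_reachable[OF t] Ws by blast
    then have "s = t" unfolding s induced_def using sub by (intro rgraph.expand) auto
    then show ?thesis unfolding is_couple_def using t
      by (auto intro: exI[of _ Total_Cut])
  next
    case False
    define C where "C = {(p, x) \<in> edges t. p \<notin> W \<and> x \<in> W}"
    have "(\<exists>(p, x) \<in> C. (x, w) \<in> (edges t)\<^sup>*)" if "(root_of t, w) \<in> (edges t)\<^sup>*" "w \<in> W" for w
      using that
    proof (induction rule: rtrancl_induct)
      case base
      then show ?case using False by simp
    next
      case (step y z)
      show ?case
      proof (cases "y \<in> W")
        case True
        then show ?thesis using step(2,3)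
          by (simp add: case_prod_beta) (meson rtrancl_into_rtrancl)
      next
        case False
        then have "(y, z) \<in> C" using step(2,4) by (simp add: C_def)
        then show ?thesis by (rule rev_bexI) simp
      qed
    qed
    then have WC: "{w. \<exists>(p, x) \<in> C. (x, w) \<in> (edges t)\<^sup>*} = W"
      using Wt rooted_tree_reachable[OF t] Ws unfolding C_def by fast
    have "card (C \<inter> path_edges xs) \<le> 1" if xs: "root_leaf_path t xs" for xs
    proof -
      have step: "(xs ! i, xs ! Suc i) \<in> edges t" if "Suc i < length xs" for i
        using xs that unfolding root_leaf_path_def successively_conv_nth by blast
      have mono: "xs ! j \<in> W" if "xs ! i \<in> W" "i \<le> j" "j < length xs" for i j
        using that(2,1,3)
      proof (induction rule: dec_induct)
        case (step n)
        then show ?case using \<open>\<And>i. Suc i < length xs \<Longrightarrow> _\<close>[of n] W by auto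
      qed auto
      have nz: "\<exists>i. Suc i < length xs \<and> e = (xs ! i, xs ! Suc i) \<and> xs ! i \<notin> W \<and> xs ! Suc i \<in> W"
        if e: "e \<in> C \<inter> path_edges xs" for e
      proof -
        obtain i where i: "i < length xs - 1" "e = (xs ! i, tl xs ! i)"
          using e by (auto simp: path_edges_def set_zip)
        then have "Suc i < length xs" "e = (xs ! i, xs ! Suc i)" by (auto simp: nth_tl)
        moreover have "xs ! i \<notin> W" "xs ! Suc i \<in> W" using e calculation by (auto simp: C_def)
        ultimately show ?thesis by blast
      qed
      have "e = e'" if e: "e \<in> C \<inter> path_edges xs" "e' \<in> C \<inter> path_edges xs" for e e'
      proof -
        obtain i where i: "Suc i < length xs" "e = (xs ! i, xs ! Suc i)" "xs ! i \<notin> W" "xs ! Suc i \<in> W"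
          using nz[OF e(1)] by blast
        obtain j where j: "Suc j < length xs" "e' = (xs ! j, xs ! Suc j)" "xs ! j \<notin> W" "xs ! Suc j \<in> W"
          using nz[OF e(2)] by blast
        have "\<not> i < j" using mono[of "Suc i" j] i j by auto
        moreover have "\<not> j < i" using mono[of "Suc j" i] i j by auto
        ultimately show ?thesis using i j by simp
      qed
      moreover have "finite (C \<inter> path_edges xs)" by (simp add: path_edges_def)
      ultimately show ?thesis by (simp add: card_le_Suc0_iff_eq)
    qed
    moreover have "C \<subseteq> edges t" by (auto simp: C_def)
    ultimately have "admissible_cut t (Edge_Cut C)" by simp
    moreover have "s = pruning t (Edge_Cut C)" using s WC by simp
    ultimately show ?thesis unfolding is_couple_def using t by blast
  qed
qed

lemma relabel_couple:
  assumes "is_couple (t, s)" "inj_on f (verts t)"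
  shows "is_couple (relabel f t, relabel f s)"
proof -
  note c = assms(1)[unfolded is_couple_iff]
  then have t: "rooted_tree t" by blast
  note sub = rooted_forest_sub[OF rooted_tree_forest[OF t]]
  have vs: "verts s \<subseteq> verts t" and es: "edges s = {(u, v) \<in> edges t. u \<in> verts s}"
    using c by simp_all
  have cl: "v \<in> verts s" if "(u, v) \<in> edges t" "u \<in> verts s" for u v
    using c that by auto
  have key: "u \<in> verts s" if "f u \<in> f ` verts s" "(u, v) \<in> edges t" for u v
    using that sub[OF that(2)] vs assms(2) by (auto simp: inj_on_image_mem_iff)
  show ?thesis
    unfolding is_couple_iff
  proof (intro conjI)
    show "rooted_tree (relabel f t)" by (rule relabel_tree(1)[OF t assms(2)])
    show "verts (relabel f s) \<subseteq> verts (relabel f t)" using vs by auto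
    show "edges (relabel f s) = {(u, v) \<in> edges (relabel f t). u \<in> verts (relabel f s)}"
    proof (intro equalityI subrelI)
      fix x y
      assume "(x, y) \<in> edges (relabel f s)"
      then obtain a b where p: "x = f a" "y = f b" "(a, b) \<in> edges s" by auto
      then have "(a, b) \<in> edges t" "a \<in> verts s" by (simp_all add: es)
      then show "(x, y) \<in> {(u, v) \<in> edges (relabel f t). u \<in> verts (relabel f s)}"
        using p(1,2) by (simp add: rev_image_eqI)
    next
      fix x y
      assume "(x, y) \<in> {(u, v) \<in> edges (relabel f t). u \<in> verts (relabel f s)}"
      then have xy: "(x, y) \<in> edges (relabel f t)" and x: "x \<in> f ` verts s"
        by (simp_all only: mem_Collect_eq prod.case verts_relabel)
      obtain a b where p: "x = f a" "y = f b" "(a, b) \<in> edges t" using xy by auto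
      have "(a, b) \<in> edges s" using key[of a b] x p by (simp add: es)
      then show "(x, y) \<in> edges (relabel f s)" using p(1,2) by (simp add: rev_image_eqI)
    qed
    have "f b \<in> f ` verts s" if "(a, b) \<in> edges t" "f a \<in> f ` verts s" for a b
      using key[OF that(2,1)] cl[OF that(1)] by blast
    then show "\<forall>(u, v) \<in> edges (relabel f t). u \<in> verts (relabel f s) \<longrightarrow> v \<in> verts (relabel f s)"
      by (auto simp del: image_iff)
  qed
qed

lemma leadsto_couple:
  assumes "is_couple (t2, s2)" "is_couple (t3, s3)" "v \<in> verts t3 - verts s3"
  shows "is_couple (graft t2 v t3, disj_union s2 s3)"
  using assms graft_tree(1)[of t2 t3 v] unfolding is_couple_iff by auto

lemma diamond_couple:
  assumes "rooted_tree t1" "is_couple (t2, s2)" "v \<in> verts s2"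
  shows "is_couple (graft t1 v t2, graft t1 v s2)"
  using assms graft_tree(1)[of t1 t2 v] rooted_forest_sub[OF rooted_tree_forest[OF assms(1)]]
    root_in_verts[OF assms(1)]
  unfolding is_couple_iff by auto

lemma part_equivp_tree_iso: "part_equivp (tree_iso :: nat rgraph \<Rightarrow> _)"
proof (rule part_equivpI)
  have "rooted_tree (RGraph {0 :: nat} {})"
    by (auto simp: rooted_tree_def rooted_forest_def roots_def acyclic_def)
  then show "\<exists>t :: nat rgraph. tree_iso t t"
    unfolding tree_iso_def
    by (intro exI[of _ "RGraph {0} {}"] conjI exI[of _ id]) (auto simp: relabel_def)
  show "symp (tree_iso :: nat rgraph \<Rightarrow> _)"
  proof (rule sympI)
    fix t t' :: "nat rgraph"
    assume "tree_iso t t'"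
    then obtain f where f: "rooted_tree t" "rooted_tree t'" "inj_on f (verts t)" "t' = relabel f t"
      by (auto simp: tree_iso_def)
    have "relabel (the_inv_into (verts t) f) t' = t"
      unfolding f(4) relabel_relabel using f rooted_forest_sub[OF rooted_tree_forest[OF f(1)]]
      by (intro relabel_ident) (auto simp: the_inv_into_f_f)
    then show "tree_iso t' t"
      unfolding tree_iso_def using f by (metis inj_on_the_inv_into verts_relabel)
  qed
  show "transp (tree_iso :: nat rgraph \<Rightarrow> _)"
  proof (rule transpI)
    fix t t' t'' :: "nat rgraph"
    assume "tree_iso t t'" "tree_iso t' t''"
    then obtain f g where "rooted_tree t" "rooted_tree t''"
      and f: "inj_on f (verts t)" "t' = relabel f t" and g: "inj_on g (verts t')" "t'' = relabel g t'"
      by (auto simp: tree_iso_def)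
    moreover have "inj_on (g \<circ> f) (verts t)" using f g by (auto intro: comp_inj_on)
    moreover have "t'' = relabel (g \<circ> f) t" using f g by (simp add: relabel_relabel)
    ultimately show "tree_iso t t''" unfolding tree_iso_def by blast
  qed
qed

lemma part_equivp_couple_iso: "part_equivp (couple_iso :: nat rgraph \<times> nat rgraph \<Rightarrow> _)"
proof (rule part_equivpI)
  have "rooted_tree (RGraph {0 :: nat} {})"
    by (auto simp: rooted_tree_def rooted_forest_def roots_def acyclic_def)
  then have "is_couple (RGraph {0 :: nat} {}, RGraph {0 :: nat} {})"
    by (simp add: is_couple_iff)
  then have "couple_iso (RGraph {0 :: nat} {}, RGraph {0 :: nat} {}) (RGraph {0 :: nat} {}, RGraph {0 :: nat} {})"
    unfolding couple_iso_def prod.case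
    by (intro conjI exI[of _ id]) (auto simp: relabel_def)
  then show "\<exists>p :: nat rgraph \<times> nat rgraph. couple_iso p p" by blast
  show "symp (couple_iso :: nat rgraph \<times> nat rgraph \<Rightarrow> _)"
  proof (rule sympI, clarify)
    fix t s t' s' :: "nat rgraph"
    assume "couple_iso (t, s) (t', s')"
    then obtain f where f: "is_couple (t, s)" "is_couple (t', s')" "inj_on f (verts t)"
        "t' = relabel f t" "s' = relabel f s"
      by (auto simp: couple_iso_def)
    have t: "rooted_tree t" and vs: "verts s \<subseteq> verts t"
      and es: "edges s \<subseteq> verts s \<times> verts s" using f(1) unfolding is_couple_iff by auto
    have "relabel (the_inv_into (verts t) f) t' = t"
      unfolding f(4) relabel_relabel using f rooted_forest_sub[OF rooted_tree_forest[OF t]]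
      by (intro relabel_ident) (auto simp: the_inv_into_f_f)
    moreover have "relabel (the_inv_into (verts t) f) s' = s"
      unfolding f(5) relabel_relabel using f vs es
      by (intro relabel_ident) (auto simp: the_inv_into_f_f)
    ultimately show "couple_iso (t', s') (t, s)"
      unfolding couple_iso_def prod.case using f by (metis inj_on_the_inv_into verts_relabel)
  qed
  show "transp (couple_iso :: nat rgraph \<times> nat rgraph \<Rightarrow> _)"
  proof (rule transpI, clarify)
    fix t s t' s' t'' s'' :: "nat rgraph"
    assume "couple_iso (t, s) (t', s')" "couple_iso (t', s') (t'', s'')"
    then obtain f g where "is_couple (t, s)" "is_couple (t'', s'')"
      and f: "inj_on f (verts t)" "t' = relabel f t" "s' = relabel f s"
      and g: "inj_on g (verts t')" "t'' = relabel g t'" "s'' = relabel g s'"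
      by (auto simp: couple_iso_def)
    moreover have "inj_on (g \<circ> f) (verts t)" using f g by (auto intro: comp_inj_on)
    moreover have "t'' = relabel (g \<circ> f) t" "s'' = relabel (g \<circ> f) s"
      using f g by (simp_all add: relabel_relabel)
    ultimately show "couple_iso (t, s) (t'', s'')" unfolding couple_iso_def prod.case by blast
  qed
qed

quotient_type rtree = "nat rgraph" / partial: tree_iso
  by (rule part_equivp_tree_iso)

quotient_type couple = "nat rgraph \<times> nat rgraph" / partial: couple_iso
  by (rule part_equivp_couple_iso)

text \<open>Grafting and disjoint union produce vertices in \<open>nat + nat\<close>. They are renamed to natural
  numbers before passing to the isomorphism class.\<close>

definition couple_class :: "(nat + nat) rgraph \<Rightarrow> (nat + nat) rgraph \<Rightarrow> couple" where
  "couple_class t s = abs_couple (relabel sum_encode t, relabel sum_encode s)"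

lemma couple_class_eqI:
  assumes "is_couple (t, s)" "inj_on f (verts t)" "t' = relabel f t" "s' = relabel f s"
  shows "couple_class t s = couple_class t' s'"
proof -
  define g where "g = sum_encode \<circ> f \<circ> sum_decode"
  have *: "relabel g (relabel sum_encode F) = relabel sum_encode (relabel f F)" for F
    unfolding relabel_relabel g_def by (simp add: comp_def)
  have c': "is_couple (t', s')" using relabel_couple[OF assms(1,2)] assms(3,4) by simp
  have e: "is_couple (relabel sum_encode t, relabel sum_encode s)" if "is_couple (t, s)" for t s
    using that by (rule relabel_couple) (rule inj_sum_encode)
  have "inj_on g (verts (relabel sum_encode t))"
    using assms(2) by (auto simp: g_def inj_on_def sum_encode_eq)
  then have "couple_iso (relabel sum_encode t, relabel sum_encode s)
      (relabel sum_encode t', relabel sum_encode s')"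
    unfolding couple_iso_def prod.case using e[OF assms(1)] e[OF c'] *[of t] *[of s] assms(3,4)
    by metis
  then show ?thesis unfolding couple_class_def using Quotient3_rel[OF Quotient3_couple] by metis
qed

lemma relabel_graft:
  assumes "rooted_tree t" "inj_on f (verts t)"
  shows "relabel (map_sum f g) (graft t v s) = graft (relabel f t) (g v) (relabel g s)"
  using relabel_tree(2)[OF assms]
  by (intro rgraph.expand) (auto simp: image_Un image_image Plus_def map_prod_def case_prod_beta)

lemma inj_on_map_sum:
  assumes "inj_on f A" "inj_on g B"
  shows "inj_on (map_sum f g) (A <+> B)"
proof (rule inj_onI)
  fix x y
  assume "x \<in> A <+> B" "y \<in> A <+> B" "map_sum f g x = map_sum f g y"
  then show "x = y"
    by (elim PlusE) (simp_all add: inj_on_eq_iff[OF assms(1)] inj_on_eq_iff[OF assms(2)])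
qed

lemma relabel_disj_union:
  "relabel (map_sum f g) (disj_union t s) = disj_union (relabel f t) (relabel g s)"
  by (intro rgraph.expand) (auto simp: image_Un image_image Plus_def map_prod_def case_prod_beta)


section \<open>The operations on the vector spaces of trees and of couples\<close>

text \<open>\<open>rtree \<Rightarrow>\<^sub>0 'k\<close> and \<open>couple \<Rightarrow>\<^sub>0 'k\<close> are the vector spaces over the field \<open>'k\<close> freely spanned by
  the trees and by the couples.\<close>

lift_definition leadsto_couples :: "couple \<Rightarrow> couple \<Rightarrow> (couple \<Rightarrow>\<^sub>0 'k::field)" is
  "\<lambda>(t2, s2) (t3, s3). \<Sum>v \<in> verts t3 - verts s3.
     Poly_Mapping.single (couple_class (graft t2 v t3) (disj_union s2 s3)) 1"
proof (clarify, goal_cases)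
  case (1 t2 s2 t2' s2' t3 s3 t3' s3')
  obtain f where c2: "is_couple (t2, s2)" and f: "inj_on f (verts t2)"
    and t2': "t2' = relabel f t2" and s2': "s2' = relabel f s2"
    using 1(1) by (auto simp: couple_iso_def)
  obtain g where c3: "is_couple (t3, s3)" and g: "inj_on g (verts t3)"
    and t3': "t3' = relabel g t3" and s3': "s3' = relabel g s3"
    using 1(2) by (auto simp: couple_iso_def)
  have tree2: "rooted_tree t2" and sub3: "verts s3 \<subseteq> verts t3"
    using c2 c3 by (auto simp: is_couple_iff)
  have inj: "inj_on (map_sum f g) (verts t2 <+> verts t3)"
    using f g by (rule inj_on_map_sum)
  have "g ` (verts t3 - verts s3) = verts t3' - verts s3'"
    unfolding t3' s3' verts_relabel by (rule inj_on_image_set_diff[OF g]) (use sub3 in auto)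
  then have bij: "bij_betw g (verts t3 - verts s3) (verts t3' - verts s3')"
    by (intro bij_betw_imageI inj_on_subset[OF g] Diff_subset)
  have eq: "couple_class (graft t2 v t3) (disj_union s2 s3) =
      couple_class (graft t2' (g v) t3') (disj_union s2' s3')"
    if "v \<in> verts t3 - verts s3" for v
    by (rule couple_class_eqI[where f = "map_sum f g", OF leadsto_couple[OF c2 c3 that]])
      (simp_all add: inj relabel_graft[OF tree2 f] relabel_disj_union t2' t3' s2' s3')
  have "(\<Sum>v \<in> verts t3 - verts s3. Poly_Mapping.single
           (couple_class (graft t2 v t3) (disj_union s2 s3)) (1 :: 'k))
      = (\<Sum>v \<in> verts t3 - verts s3. Poly_Mapping.single
           (couple_class (graft t2' (g v) t3') (disj_union s2' s3')) 1)"
    using eq by (intro sum.cong) simp_all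
  also have "\<dots> = (\<Sum>v \<in> verts t3' - verts s3'. Poly_Mapping.single
           (couple_class (graft t2' v t3') (disj_union s2' s3')) 1)"
    by (rule sum.reindex_bij_betw[OF bij])
  finally show ?case .
qed

lift_definition diamond_couple :: "rtree \<Rightarrow> couple \<Rightarrow> (couple \<Rightarrow>\<^sub>0 'k::field)" is
  "\<lambda>t1 (t2, s2). \<Sum>v \<in> verts s2.
     Poly_Mapping.single (couple_class (graft t1 v t2) (graft t1 v s2)) 1"
proof (clarify, goal_cases)
  case (1 t1 t1' t2 s2 t2' s2')
  obtain f where tree1: "rooted_tree t1" and f: "inj_on f (verts t1)" and t1': "t1' = relabel f t1"
    using 1(1) by (auto simp: tree_iso_def)
  obtain g where c2: "is_couple (t2, s2)" and g: "inj_on g (verts t2)"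
    and t2': "t2' = relabel g t2" and s2': "s2' = relabel g s2"
    using 1(2) by (auto simp: couple_iso_def)
  have sub2: "verts s2 \<subseteq> verts t2" using c2 by (auto simp: is_couple_iff)
  have inj: "inj_on (map_sum f g) (verts t1 <+> verts t2)"
    using f g by (rule inj_on_map_sum)
  have bij: "bij_betw g (verts s2) (verts s2')"
    unfolding s2' by (intro bij_betw_imageI inj_on_subset[OF g] sub2) simp
  have eq: "couple_class (graft t1 v t2) (graft t1 v s2) =
      couple_class (graft t1' (g v) t2') (graft t1' (g v) s2')"
    if "v \<in> verts s2" for v
    by (rule couple_class_eqI[where f = "map_sum f g", OF diamond_couple[OF tree1 c2 that]])
      (simp_all add: inj relabel_graft[OF tree1 f] t1' t2' s2')
  have "(\<Sum>v \<in> verts s2. Poly_Mapping.single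
           (couple_class (graft t1 v t2) (graft t1 v s2)) (1 :: 'k))
      = (\<Sum>v \<in> verts s2. Poly_Mapping.single
           (couple_class (graft t1' (g v) t2') (graft t1' (g v) s2')) 1)"
    using eq by (intro sum.cong) simp_all
  also have "\<dots> = (\<Sum>v \<in> verts s2'. Poly_Mapping.single
           (couple_class (graft t1' v t2') (graft t1' v s2')) 1)"
    by (rule sum.reindex_bij_betw[OF bij])
  finally show ?case .
qed

definition scale :: "'k::field \<Rightarrow> ('b \<Rightarrow>\<^sub>0 'k) \<Rightarrow> ('b \<Rightarrow>\<^sub>0 'k)" where
  "scale c x = Poly_Mapping.map ((*) c) x"

definition bilinear_ext ::
  "('a \<Rightarrow> 'b \<Rightarrow> ('c \<Rightarrow>\<^sub>0 'k::field)) \<Rightarrow> ('a \<Rightarrow>\<^sub>0 'k) \<Rightarrow> ('b \<Rightarrow>\<^sub>0 'k) \<Rightarrow> ('c \<Rightarrow>\<^sub>0 'k)" where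
  "bilinear_ext f x y = (\<Sum>a \<in> Poly_Mapping.keys x. \<Sum>b \<in> Poly_Mapping.keys y.
     scale (Poly_Mapping.lookup x a * Poly_Mapping.lookup y b) (f a b))"

lemma lookup_scale [simp]: "Poly_Mapping.lookup (scale c x) a = c * Poly_Mapping.lookup x a"
  unfolding scale_def by (simp add: Poly_Mapping.map.rep_eq when_def)

lemma scale_zero: "scale 0 x = 0"
  by (rule poly_mapping_eqI) simp

lemma vector_space_scale: "vector_space scale"
  by unfold_locales (rule poly_mapping_eqI; simp add: lookup_add algebra_simps)+

lemma bilinear_ext_superset:
  assumes "finite A" "Poly_Mapping.keys x \<subseteq> A" "finite B" "Poly_Mapping.keys y \<subseteq> B"
  shows "bilinear_ext f x y = (\<Sum>a \<in> A. \<Sum>b \<in> B.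
     scale (Poly_Mapping.lookup x a * Poly_Mapping.lookup y b) (f a b))"
proof -
  have "(\<Sum>b \<in> Poly_Mapping.keys y. scale (Poly_Mapping.lookup x a * Poly_Mapping.lookup y b) (f a b))
      = (\<Sum>b \<in> B. scale (Poly_Mapping.lookup x a * Poly_Mapping.lookup y b) (f a b))" for a
    using assms by (intro sum.mono_neutral_left) (auto simp: in_keys_iff scale_zero)
  then show ?thesis unfolding bilinear_ext_def
    using assms by (simp, intro sum.mono_neutral_left) (auto simp: in_keys_iff scale_zero)
qed

lemma bilinear_ext_single:
  "bilinear_ext f (Poly_Mapping.single a 1) (Poly_Mapping.single b 1) = f a b"
  unfolding bilinear_ext_def by (simp, rule poly_mapping_eqI) simp

lemma linear_bilinear_ext_right:
  fixes f :: "'a \<Rightarrow> 'b \<Rightarrow> ('c \<Rightarrow>\<^sub>0 'd::field)"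
  shows "Vector_Spaces.linear scale scale (\<lambda>y. bilinear_ext f x y)"
proof (intro Vector_Spaces.linear_iff[THEN iffD2] conjI allI vector_space_scale)
  fix y z :: "'b \<Rightarrow>\<^sub>0 'd"
  show "bilinear_ext f x (y + z) = bilinear_ext f x y + bilinear_ext f x z"
    using Poly_Mapping.keys_add[of y z]
    by (simp add: bilinear_ext_superset[where A = "Poly_Mapping.keys x" and
          B = "Poly_Mapping.keys y \<union> Poly_Mapping.keys z"] flip: sum.distrib)
      (intro sum.cong refl poly_mapping_eqI, simp add: lookup_add algebra_simps)
next
  fix c and y :: "'b \<Rightarrow>\<^sub>0 'd"
  have "Poly_Mapping.keys (scale c y) \<subseteq> Poly_Mapping.keys y" by (auto simp: in_keys_iff)
  then show "bilinear_ext f x (scale c y) = scale c (bilinear_ext f x y)"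
    by (simp add: bilinear_ext_superset[where A = "Poly_Mapping.keys x" and B = "Poly_Mapping.keys y"])
      (rule poly_mapping_eqI, simp add: lookup_sum sum_distrib_left algebra_simps)
qed

lemma bilinear_ext_flip: "bilinear_ext f x y = bilinear_ext (\<lambda>b a. f a b) y x"
  unfolding bilinear_ext_def by (subst sum.swap) (simp add: mult.commute)

lemma linear_bilinear_ext_left: "Vector_Spaces.linear scale scale (\<lambda>x. bilinear_ext f x y)"
  unfolding bilinear_ext_flip[of f _ y] by (rule linear_bilinear_ext_right)

definition leadsto ::
  "(couple \<Rightarrow>\<^sub>0 'k::field) \<Rightarrow> (couple \<Rightarrow>\<^sub>0 'k) \<Rightarrow> (couple \<Rightarrow>\<^sub>0 'k)" (infixl "\<leadsto>" 70) where
  "x \<leadsto> y = bilinear_ext leadsto_couples x y"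

definition diamond ::
  "(rtree \<Rightarrow>\<^sub>0 'k::field) \<Rightarrow> (couple \<Rightarrow>\<^sub>0 'k) \<Rightarrow> (couple \<Rightarrow>\<^sub>0 'k)" (infixl "\<Diamond>" 75) where
  "x \<Diamond> y = bilinear_ext diamond_couple x y"

definition derivation ::
  "(('b \<Rightarrow>\<^sub>0 'k::field) \<Rightarrow> ('b \<Rightarrow>\<^sub>0 'k) \<Rightarrow> ('b \<Rightarrow>\<^sub>0 'k)) \<Rightarrow> (('b \<Rightarrow>\<^sub>0 'k) \<Rightarrow> ('b \<Rightarrow>\<^sub>0 'k)) \<Rightarrow> bool" where
  "derivation mult D \<longleftrightarrow> Vector_Spaces.linear scale scale D \<and>
     (\<forall>x y. D (mult x y) = mult (D x) y + mult x (D y))"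

end

theory Submission
  imports Defs "HOL-Library.Countable"
begin

text \<open>By multilinearity it suffices to treat basis elements. A vertex of \<open>s\<^sub>2s\<^sub>3\<close> lies either in
  \<open>s\<^sub>2\<close> or in \<open>s\<^sub>3\<close>. In the first case, grafting \<open>t\<^sub>1\<close> on it commutes with grafting \<open>t\<^sub>2\<close> on \<open>t\<^sub>3\<close>
  because the root of \<open>t\<^sub>2\<close> is unchanged. In the second case, \<open>t\<^sub>1\<close> and \<open>t\<^sub>2\<close> are both grafted on
  \<open>t\<^sub>3\<close>, and the vertices outside the subforest are the same before and after grafting \<open>t\<^sub>1\<close>, since
  the vertices of \<open>t\<^sub>1\<close> are added to the subforest as well.\<close>

section \<open>Isomorphism classes and the choice of representatives\<close>

lemma couple_iso_refl: "is_couple p \<Longrightarrow> couple_iso p p"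
  by (cases p) (auto simp: couple_iso_def relabel_def map_prod.id intro!: exI[of _ id])

lemma tree_iso_refl: "rooted_tree t \<Longrightarrow> tree_iso t t"
  by (auto simp: tree_iso_def relabel_def map_prod.id intro!: exI[of _ id])

lemma abs_couple_relabel:
  assumes "is_couple (t, s)" "inj_on f (verts t)"
  shows "abs_couple (relabel f t, relabel f s) = abs_couple (t, s)"
proof -
  have "couple_iso (t, s) (relabel f t, relabel f s)"
    unfolding couple_iso_def prod.case using assms relabel_couple[OF assms] by blast
  then show ?thesis using Quotient3_rel[OF Quotient3_couple] by metis
qed

text \<open>Iterated grafting leads to vertices in nested sum types, so classes are needed for vertices
  of any countable type.\<close>

definition class_of :: "'a::countable rgraph \<Rightarrow> 'a rgraph \<Rightarrow> couple" where
  "class_of t s = abs_couple (relabel to_nat t, relabel to_nat s)"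

text \<open>Since \<open>from_nat\<close> undoes \<open>to_nat\<close>, conjugating \<open>f\<close>
  by these encodings gives a renaming of natural numbers, to which \<open>abs_couple_relabel\<close>
  applies. Equality of two classes thus reduces to exhibiting one injective renaming of
  vertices.\<close>

lemma class_of_relabel:
  assumes "is_couple (t, s)" "inj_on f (verts t)"
  shows "class_of (relabel f t) (relabel f s) = class_of t s"
proof -
  define g where "g = to_nat \<circ> f \<circ> (from_nat :: nat \<Rightarrow> 'a)"
  have *: "relabel to_nat (relabel f F) = relabel g (relabel to_nat F)" for F
    unfolding relabel_relabel g_def by (simp add: comp_def)
  have "is_couple (relabel to_nat t, relabel to_nat s)"
    using assms(1) by (rule relabel_couple) simp
  moreover have "inj_on g (verts (relabel to_nat t))"
    using assms(2) by (auto simp: g_def inj_on_def)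
  ultimately show ?thesis unfolding class_of_def * by (rule abs_couple_relabel)
qed

lemma class_of_nat: "is_couple (t, s) \<Longrightarrow> class_of t s = abs_couple (t, s)"
  unfolding class_of_def by (rule abs_couple_relabel) simp_all

text \<open>The quotient is partial: a representative is related to itself by
  \<open>couple_iso\<close>, and this already forces it to be a couple.\<close>

lemma couple_cases:
  obtains t s :: "nat rgraph" where "C = class_of t s" "is_couple (t, s)"
proof (induction C rule: couple.abs_induct)
  case (1 p)
  then show ?case by (cases p) (auto simp: couple_iso_def class_of_nat)
qed

text \<open>The two sides encode \<open>nat + nat\<close> by possibly different injections,
  \<open>sum_encode\<close> and \<open>to_nat\<close>; a renaming by \<open>sum_encode\<close>
  leaves \<open>class_of\<close> unchanged.\<close>

lemma couple_class_conv: "is_couple (t, s) \<Longrightarrow> couple_class t s = class_of t s"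
  using class_of_relabel[of t s sum_encode] relabel_couple[of t s sum_encode]
  by (simp add: couple_class_def class_of_nat inj_sum_encode)

text \<open>The lifted definition computes only on representatives over \<open>nat\<close>. Allowing
  any countable vertex types makes the sum applicable to couples that are themselves results of
  grafting.\<close>

lemma leadsto_couples_class_of:
  fixes t2 s2 :: "'a::countable rgraph" and t3 s3 :: "'b::countable rgraph"
  assumes c2: "is_couple (t2, s2)" and c3: "is_couple (t3, s3)"
  shows "leadsto_couples (class_of t2 s2) (class_of t3 s3) = (\<Sum>v \<in> verts t3 - verts s3.
    Poly_Mapping.single (class_of (graft t2 v t3) (disj_union s2 s3)) (1 :: 'k::field))"
proof -
  define f :: "'a \<Rightarrow> nat" where "f = to_nat"
  define g :: "'b \<Rightarrow> nat" where "g = to_nat"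
  have f: "inj_on f A" and g: "inj_on g B" for A B by (simp_all add: f_def g_def)
  have d2: "is_couple (relabel f t2, relabel f s2)" and d3: "is_couple (relabel g t3, relabel g s3)"
    using relabel_couple c2 c3 f g by blast+
  have tree2: "rooted_tree t2" using c2 by (simp add: is_couple_iff)
  have img: "verts (relabel g t3) - verts (relabel g s3) = g ` (verts t3 - verts s3)"
    using g[of UNIV] by (simp add: image_set_diff)
  have eq: "couple_class (graft (relabel f t2) (g v) (relabel g t3))
      (disj_union (relabel f s2) (relabel g s3)) = class_of (graft t2 v t3) (disj_union s2 s3)"
    if v: "v \<in> verts t3 - verts s3" for v
  proof -
    have "is_couple (graft (relabel f t2) (g v) (relabel g t3),
        disj_union (relabel f s2) (relabel g s3))"
      using d2 d3 by (rule leadsto_couple) (use img v in blast)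
    then show ?thesis
      using class_of_relabel[OF leadsto_couple[OF c2 c3 v], of "map_sum f g"]
      by (simp add: couple_class_conv relabel_graft[OF tree2 f] relabel_disj_union
          inj_on_map_sum f g)
  qed
  have "leadsto_couples (class_of t2 s2) (class_of t3 s3) =
      (\<Sum>v \<in> verts (relabel g t3) - verts (relabel g s3). Poly_Mapping.single
        (couple_class (graft (relabel f t2) v (relabel g t3))
          (disj_union (relabel f s2) (relabel g s3))) (1 :: 'k))"
    unfolding class_of_def f_def[symmetric] g_def[symmetric]
    by (simp add: leadsto_couples.abs_eq couple_iso_refl d2 d3)
  also have "\<dots> = (\<Sum>v \<in> verts t3 - verts s3.
      Poly_Mapping.single (class_of (graft t2 v t3) (disj_union s2 s3)) 1)"
    unfolding img by (subst sum.reindex[OF g]) (simp add: eq)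
  finally show ?thesis .
qed

text \<open>Here \<open>t1\<close> can stay over \<open>nat\<close>, because in the derivation
  identity the left factor of the diamond is never a result of grafting.\<close>

lemma diamond_couple_class_of:
  fixes t2 s2 :: "'a::countable rgraph"
  assumes t1: "rooted_tree t1" and c2: "is_couple (t2, s2)"
  shows "diamond_couple (abs_rtree t1) (class_of t2 s2) = (\<Sum>v \<in> verts s2.
    Poly_Mapping.single (class_of (graft t1 v t2) (graft t1 v s2)) (1 :: 'k::field))"
proof -
  define g :: "'a \<Rightarrow> nat" where "g = to_nat"
  have g: "inj_on g B" for B by (simp add: g_def)
  have d2: "is_couple (relabel g t2, relabel g s2)"
    using relabel_couple c2 g by blast
  have id: "relabel id t1 = t1" by (simp add: relabel_def map_prod.id)
  have eq: "couple_class (graft t1 (g v) (relabel g t2)) (graft t1 (g v) (relabel g s2)) =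
      class_of (graft t1 v t2) (graft t1 v s2)"
    if v: "v \<in> verts s2" for v
  proof -
    have "is_couple (graft t1 (g v) (relabel g t2), graft t1 (g v) (relabel g s2))"
      using t1 d2 by (rule diamond_couple) (use v in simp)
    then show ?thesis
      using class_of_relabel[OF diamond_couple[OF t1 c2 v], of "map_sum id g"]
      by (simp add: couple_class_conv relabel_graft[OF t1 inj_on_id] id inj_on_map_sum g)
  qed
  have "diamond_couple (abs_rtree t1) (class_of t2 s2) =
      (\<Sum>v \<in> verts (relabel g s2). Poly_Mapping.single
        (couple_class (graft t1 v (relabel g t2)) (graft t1 v (relabel g s2))) (1 :: 'k))"
    unfolding class_of_def g_def[symmetric]
    by (simp add: diamond_couple.abs_eq couple_iso_refl tree_iso_refl d2 t1)
  also have "\<dots> = (\<Sum>v \<in> verts s2.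
      Poly_Mapping.single (class_of (graft t1 v t2) (graft t1 v s2)) 1)"
    unfolding verts_relabel by (subst sum.reindex[OF g]) (simp add: eq)
  finally show ?thesis .
qed

section \<open>Rearranging iterated grafts\<close>

fun sum_assoc :: "'a + ('b + 'c) \<Rightarrow> ('a + 'b) + 'c" where
  "sum_assoc (Inl x) = Inl (Inl x)"
| "sum_assoc (Inr (Inl y)) = Inl (Inr y)"
| "sum_assoc (Inr (Inr z)) = Inr z"

fun sum_left_commute :: "'a + ('b + 'c) \<Rightarrow> 'b + ('a + 'c)" where
  "sum_left_commute (Inl x) = Inr (Inl x)"
| "sum_left_commute (Inr (Inl y)) = Inl y"
| "sum_left_commute (Inr (Inr z)) = Inr (Inr z)"

lemma inj_sum_assoc: "inj sum_assoc"
proof (rule injI)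
  show "sum_assoc x = sum_assoc y \<Longrightarrow> x = y" for x y :: "'a + ('b + 'c)"
    by (cases x rule: sum_assoc.cases; cases y rule: sum_assoc.cases) auto
qed

lemma inj_sum_left_commute: "inj sum_left_commute"
proof (rule injI)
  show "sum_left_commute x = sum_left_commute y \<Longrightarrow> x = y" for x y :: "'a + ('b + 'c)"
    by (cases x rule: sum_assoc.cases; cases y rule: sum_assoc.cases) auto
qed

text \<open>Since \<open>a\<close> is a vertex of \<open>t2\<close>, the root of
  \<open>graft t1 a t2\<close> is still that of \<open>t2\<close>, so both sides attach the same
  vertex below \<open>v\<close>.\<close>

lemma relabel_graft_graft:
  assumes "rooted_tree t1" "rooted_tree t2" "a \<in> verts t2"
  shows "relabel sum_assoc (graft t1 (Inl a) (graft t2 v t3)) = graft (graft t1 a t2) v t3"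
  by (intro rgraph.expand)
    (auto simp: graft_tree(2)[OF assms] image_Un image_image Plus_def map_prod_def case_prod_beta)

lemma relabel_graft_disj_union:
  "relabel sum_assoc (graft t1 (Inl a) (disj_union s2 s3)) = disj_union (graft t1 a s2) s3"
  by (intro rgraph.expand) (auto simp: image_Un image_image Plus_def map_prod_def case_prod_beta)

text \<open>Both trees are attached to \<open>t3\<close> by their own roots, so the order of the two
  grafts affects only the nesting of the vertex type.\<close>

lemma relabel_graft_graft_commute:
  "relabel sum_left_commute (graft t1 (Inr b) (graft t2 v t3)) = graft t2 (Inr v) (graft t1 b t3)"
  by (intro rgraph.expand) (auto simp: image_Un image_image Plus_def map_prod_def case_prod_beta)

lemma relabel_graft_disj_union_commute:
  "relabel sum_left_commute (graft t1 (Inr b) (disj_union s2 s3)) = disj_union s2 (graft t1 b s3)"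
  by (intro rgraph.expand) (auto simp: image_Un image_image Plus_def map_prod_def case_prod_beta)

section \<open>Bilinearity and reduction to basis elements\<close>

lemma leadsto_add_left: "(x + y) \<leadsto> z = x \<leadsto> z + y \<leadsto> z"
  and leadsto_scale_left: "scale c x \<leadsto> z = scale c (x \<leadsto> z)"
  and leadsto_add_right: "z \<leadsto> (x + y) = z \<leadsto> x + z \<leadsto> y"
  and leadsto_scale_right: "z \<leadsto> scale c x = scale c (z \<leadsto> x)"
  using linear_bilinear_ext_left[of leadsto_couples z] linear_bilinear_ext_right[of leadsto_couples z]
  unfolding Vector_Spaces.linear_iff leadsto_def by auto

lemma diamond_add_left: "(x + y) \<Diamond> z = x \<Diamond> z + y \<Diamond> z"
  and diamond_scale_left: "scale c x \<Diamond> z = scale c (x \<Diamond> z)"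
  using linear_bilinear_ext_left[of diamond_couple z]
  unfolding Vector_Spaces.linear_iff diamond_def by auto

lemma diamond_add_right: "u \<Diamond> (y + z) = u \<Diamond> y + u \<Diamond> z"
  and diamond_scale_right: "u \<Diamond> scale c z = scale c (u \<Diamond> z)"
  using linear_bilinear_ext_right[of diamond_couple u]
  unfolding Vector_Spaces.linear_iff diamond_def by auto

lemma scale_add_right: "scale c (x + y) = scale c x + scale c y"
  by (rule poly_mapping_eqI) (simp add: lookup_add algebra_simps)

lemmas bilinear_simps = leadsto_add_left leadsto_scale_left leadsto_add_right leadsto_scale_right
  diamond_add_left diamond_scale_left diamond_add_right diamond_scale_right scale_add_right

lemma additive_sum:
  fixes f :: "'a::ab_group_add \<Rightarrow> 'b::ab_group_add"
  assumes "\<And>x y. f (x + y) = f x + f y"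
  shows "f (sum g A) = (\<Sum>a \<in> A. f (g a))"
proof -
  have "f 0 = 0" using assms[of 0 0] by simp
  then show ?thesis using assms by (induction A rule: infinite_finite_induct) auto
qed

text \<open>Every vector is the finite sum of its coordinates times basis vectors, and additivity
  and homogeneity carry the agreement over to such sums.\<close>

lemma linear_eq_on_single:
  fixes f g :: "('a \<Rightarrow>\<^sub>0 'k::field) \<Rightarrow> ('b \<Rightarrow>\<^sub>0 'k)"
  assumes f: "\<And>x y. f (x + y) = f x + f y" "\<And>c x. f (scale c x) = scale c (f x)"
    and g: "\<And>x y. g (x + y) = g x + g y" "\<And>c x. g (scale c x) = scale c (g x)"
    and eq: "\<And>a. f (Poly_Mapping.single a 1) = g (Poly_Mapping.single a 1)"
  shows "f x = g x"
proof -
  have x: "x = (\<Sum>a \<in> Poly_Mapping.keys x. scale (Poly_Mapping.lookup x a) (Poly_Mapping.single a 1))"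
    by (rule poly_mapping_eqI)
      (simp add: lookup_sum lookup_single when_def sum.delta in_keys_iff if_distrib cong: if_cong)
  show ?thesis by (subst (1 2) x) (simp add: additive_sum[of f] additive_sum[of g] f g eq)
qed

section \<open>The derivation identity\<close>

lemma leadsto_single:
  "Poly_Mapping.single p 1 \<leadsto> Poly_Mapping.single q 1 = leadsto_couples p q"
  by (simp add: leadsto_def bilinear_ext_single)

lemma diamond_single:
  "Poly_Mapping.single t 1 \<Diamond> Poly_Mapping.single q 1 = diamond_couple t q"
  by (simp add: diamond_def bilinear_ext_single)

lemma diamond_leadsto_single:
  "Poly_Mapping.single T1 (1 :: 'k::field) \<Diamond> (Poly_Mapping.single C2 1 \<leadsto> Poly_Mapping.single C3 1) =
    (Poly_Mapping.single T1 1 \<Diamond> Poly_Mapping.single C2 1) \<leadsto> Poly_Mapping.single C3 1 +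
    Poly_Mapping.single C2 1 \<leadsto> (Poly_Mapping.single T1 1 \<Diamond> Poly_Mapping.single C3 1)"
proof -
  obtain t1 where T1: "T1 = abs_rtree t1" and t1: "rooted_tree t1"
    by (induction T1 rule: rtree.abs_induct) (auto simp: tree_iso_def)
  obtain t2 s2 :: "nat rgraph" where C2: "C2 = class_of t2 s2" and c2: "is_couple (t2, s2)"
    by (rule couple_cases)
  obtain t3 s3 :: "nat rgraph" where C3: "C3 = class_of t3 s3" and c3: "is_couple (t3, s3)"
    by (rule couple_cases)
  have t2: "rooted_tree t2" and s2: "verts s2 \<subseteq> verts t2" and t3: "rooted_tree t3"
    and s3: "verts s3 \<subseteq> verts t3"
    using c2 c3 by (auto simp: is_couple_iff)
  have fin: "finite (verts s2)" "finite (verts s3)"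
    using s2 s3 rooted_forest_finite[OF rooted_tree_forest] t2 t3 finite_subset by blast+
  define V where "V = verts t3 - verts s3"
  let ?S = "\<lambda>t s. Poly_Mapping.single (class_of t s) (1 :: 'k)"
  \<comment> \<open>The vertex types are left general in this formula and the next, which are
    applied both to the given couples and to couples over \<open>nat + nat\<close>.\<close>
  have diamond: "Poly_Mapping.single T1 1 \<Diamond> ?S t s = (\<Sum>w \<in> verts s. ?S (graft t1 w t) (graft t1 w s))"
    if "is_couple (t, s)" for t s :: "'b::countable rgraph"
    using that t1 by (simp add: diamond_single T1 diamond_couple_class_of)
  have leadsto: "?S t s \<leadsto> ?S t' s' = (\<Sum>v \<in> verts t' - verts s'. ?S (graft t v t') (disj_union s s'))"
    if "is_couple (t, s)" "is_couple (t', s')"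
    for t s :: "'b::countable rgraph" and t' s' :: "'c::countable rgraph"
    using that by (simp add: leadsto_single leadsto_couples_class_of)
  have "Poly_Mapping.single T1 1 \<Diamond> (?S t2 s2 \<leadsto> ?S t3 s3) =
      (\<Sum>v \<in> V. \<Sum>w \<in> verts s2 <+> verts s3.
        ?S (graft t1 w (graft t2 v t3)) (graft t1 w (disj_union s2 s3)))"
    by (simp add: leadsto[OF c2 c3] additive_sum diamond_add_right diamond leadsto_couple[OF c2 c3]
        flip: V_def)
  also have "\<dots> = (\<Sum>v \<in> V. \<Sum>a \<in> verts s2.
        ?S (graft t1 (Inl a) (graft t2 v t3)) (graft t1 (Inl a) (disj_union s2 s3))) +
      (\<Sum>v \<in> V. \<Sum>b \<in> verts s3.
        ?S (graft t1 (Inr b) (graft t2 v t3)) (graft t1 (Inr b) (disj_union s2 s3)))"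
    by (simp add: sum.Plus fin sum.distrib)
  also have "(\<Sum>v \<in> V. \<Sum>a \<in> verts s2.
        ?S (graft t1 (Inl a) (graft t2 v t3)) (graft t1 (Inl a) (disj_union s2 s3))) =
      (\<Sum>a \<in> verts s2. \<Sum>v \<in> V. ?S (graft (graft t1 a t2) v t3) (disj_union (graft t1 a s2) s3))"
  \<comment> \<open>The sum over \<open>a\<close> goes outside because the target expands the
    diamond product with \<open>(t2, s2)\<close> first and only then grafts on
    \<open>t3\<close>.\<close>
  proof (subst sum.swap, intro sum.cong refl)
    fix a v
    assume a: "a \<in> verts s2" and v: "v \<in> V"
    have "is_couple (graft t1 (Inl a) (graft t2 v t3), graft t1 (Inl a) (disj_union s2 s3))"
      using a v by (intro diamond_couple t1 leadsto_couple c2 c3) (auto simp: V_def)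
    from class_of_relabel[OF this inj_on_subset[OF inj_sum_assoc subset_UNIV]]
    show "?S (graft t1 (Inl a) (graft t2 v t3)) (graft t1 (Inl a) (disj_union s2 s3)) =
        ?S (graft (graft t1 a t2) v t3) (disj_union (graft t1 a s2) s3)"
      using a s2 by (simp add: relabel_graft_graft t1 t2 relabel_graft_disj_union subsetD)
  qed
  also have "\<dots> = (Poly_Mapping.single T1 1 \<Diamond> ?S t2 s2) \<leadsto> ?S t3 s3"
    by (simp add: diamond[OF c2] additive_sum[of "\<lambda>y. y \<leadsto> _"] leadsto_add_left leadsto
        diamond_couple[OF t1 c2] c3 V_def)
  also have "(\<Sum>v \<in> V. \<Sum>b \<in> verts s3.
        ?S (graft t1 (Inr b) (graft t2 v t3)) (graft t1 (Inr b) (disj_union s2 s3))) =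
      (\<Sum>b \<in> verts s3. \<Sum>v \<in> V. ?S (graft t2 (Inr v) (graft t1 b t3)) (disj_union s2 (graft t1 b s3)))"
  proof (subst sum.swap, intro sum.cong refl)
    fix b v
    assume b: "b \<in> verts s3" and v: "v \<in> V"
    have "is_couple (graft t1 (Inr b) (graft t2 v t3), graft t1 (Inr b) (disj_union s2 s3))"
      using b v by (intro diamond_couple t1 leadsto_couple c2 c3) (auto simp: V_def)
    from class_of_relabel[OF this inj_on_subset[OF inj_sum_left_commute subset_UNIV]]
    show "?S (graft t1 (Inr b) (graft t2 v t3)) (graft t1 (Inr b) (disj_union s2 s3)) =
        ?S (graft t2 (Inr v) (graft t1 b t3)) (disj_union s2 (graft t1 b s3))"
      by (simp add: relabel_graft_graft_commute relabel_graft_disj_union_commute)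
  qed
  also have "\<dots> = ?S t2 s2 \<leadsto> (Poly_Mapping.single T1 1 \<Diamond> ?S t3 s3)"
  proof -
    \<comment> \<open>The vertices of \<open>t1\<close> cancel in the difference, so the index set
      \<open>V\<close> does not depend on \<open>b\<close>, up to the injection
      \<open>Inr\<close>.\<close>
    have "verts (graft t1 b t3) - verts (graft t1 b s3) = Inr ` V" for b
      by (auto simp: V_def)
    then show ?thesis
      by (simp add: diamond[OF c3] additive_sum leadsto_add_right leadsto
          diamond_couple[OF t1 c3] c2 sum.reindex del: verts_graft)
  qed
  finally show ?thesis by (simp only: C2 C3)
qed

theorem theorem8:
  fixes x :: "rtree \<Rightarrow>\<^sub>0 'k::field"
  shows "derivation (\<leadsto>) (\<lambda>y. x \<Diamond> y)"
proof -
  have "x \<Diamond> (y \<leadsto> z) = (x \<Diamond> y) \<leadsto> z + y \<leadsto> (x \<Diamond> z)" for y z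
  \<comment> \<open>Both sides are linear in each of \<open>x\<close>, \<open>y\<close>,
    \<open>z\<close> separately, so these are replaced by basis vectors one after the other.\<close>
  proof (rule linear_eq_on_single[of "\<lambda>x. x \<Diamond> (y \<leadsto> z)"])
    fix T1 :: rtree
    let ?x = "Poly_Mapping.single T1 (1 :: 'k)"
    show "?x \<Diamond> (y \<leadsto> z) = (?x \<Diamond> y) \<leadsto> z + y \<leadsto> (?x \<Diamond> z)"
    proof (rule linear_eq_on_single[of "\<lambda>y. ?x \<Diamond> (y \<leadsto> z)"])
      fix C2 :: couple
      let ?y = "Poly_Mapping.single C2 (1 :: 'k)"
      show "?x \<Diamond> (?y \<leadsto> z) = (?x \<Diamond> ?y) \<leadsto> z + ?y \<leadsto> (?x \<Diamond> z)"
        by (rule linear_eq_on_single[of "\<lambda>z. ?x \<Diamond> (?y \<leadsto> z)"])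
          (simp_all only: bilinear_simps diamond_leadsto_single ac_simps)
    qed (simp_all only: bilinear_simps ac_simps)
  qed (simp_all only: bilinear_simps ac_simps)
  then show ?thesis
    unfolding derivation_def diamond_def using linear_bilinear_ext_right by blast
qed

end
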